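(* Let $L_f,L_r\in C^2(\mathbb{R}^p)$, $\rho>0$, and let $w\in\mathbb{R}^p$ satisfy $g_r(w)\neq0$ and $q(w)\neq 0$. Let $J_{\delta_{\mathrm{rosu}}}(w)$ be the Jacobian at $w$ of the map $\delta_{\mathrm{rosu}}$, and define $$\widehat J_{\delta_{\mathrm{rosu}}}(w)=\frac{\rho}{\|q(w)\|_2}\bigl(I-P_r(w)-P_\perp(w)\bigr),\qquad \widehat\nabla F_{\mathrm{rosu}}(w)=\bigl(I+\widehat J_{\delta_{\mathrm{rosu}}}(w)^\top\bigr)\widetilde g_r(w).$$ Assume there are constants $\varepsilon_H,\varepsilon_P\ge0$ such that $$\|\nabla^2L_f(w)-I\|_{\mathrm{op}}\le\varepsilon_H,\qquad \sup_{\|\xi\|_2=1}\|DP_r(w)[\xi]\|_{\mathrm{op}}\le\varepsilon_P,$$ where $DP_r(w)[\xi]$ is the directional derivative of $P_r$ at $w$ along $\xi\in\mathbb{R}^p$. Then $$\bigl\|J_{\delta_{\mathrm{rosu}}}(w)-\widehat J_{\delta_{\mathrm{rosu}}}(w)\bigr\|_{\mathrm{op}}\le\frac{\rho}{\|q(w)\|_2}\Bigl(\varepsilon_H+\varepsilon_P\|g_f(w)\|_2\Bigr)$$ and $$\bigl\|\nabla F_{\mathrm{rosu}}(w)-\widehat\nabla F_{\mathrm{rosu}}(w)\bigr\|_2\le\frac{\rho\,\|\widetilde g_r(w)\|_2}{\|q(w)\|_2}\Bigl(\varepsilon_H+\varepsilon_P\|g_f(w)\|_2\Bigr).$$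
   Context: $L_f,L_r:\mathbb{R}^p\to\mathbb{R}$ are the forget and retain losses, with gradients $g_f=\nabla L_f$, $g_r=\nabla L_r$. Wherever the denominators are nonzero, define $$P_r(w)=\frac{g_r(w)g_r(w)^\top}{\|g_r(w)\|_2^2},\quad q(w)=(I-P_r(w))g_f(w),\quad P_\perp(w)=\frac{q(w)q(w)^\top}{\|q(w)\|_2^2},\quad \delta_{\mathrm{rosu}}(w)=\rho\,\frac{q(w)}{\|q(w)\|_2},$$ $$F_{\mathrm{rosu}}(w)=L_r\bigl(w+\delta_{\mathrm{rosu}}(w)\bigr),\qquad \widetilde g_r(w)=\nabla L_r\bigl(w+\delta_{\mathrm{rosu}}(w)\bigr)=g_r\bigl(w+\delta_{\mathrm{rosu}}(w)\bigr).$$ These maps are defined in a neighbourhood of any point where $g_r\ne0$ and $q\neq 0$. *)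

theory Defs
  imports "HOL-Analysis.Analysis"
begin

definition grad :: "(real^'n \<Rightarrow> real) \<Rightarrow> real^'n \<Rightarrow> real^'n" where
  "grad f x = (THE D. GDERIV f x :> D)"

definition hessian :: "(real^'n \<Rightarrow> real) \<Rightarrow> real^'n \<Rightarrow> real^'n^'n" where
  "hessian f x = jacobian (grad f) (at x)"

(* Both differentiability conjuncts are needed: grad and hessian are total functions whose
   value is arbitrary where the derivative does not exist. *)
definition C2 :: "(real^'n \<Rightarrow> real) \<Rightarrow> bool" where
  "C2 f \<longleftrightarrow> f differentiable_on UNIV \<and> grad f differentiable_on UNIV \<and>
    continuous_on UNIV (hessian f)"

definition dir_deriv :: "(real^'n \<Rightarrow> 'b::real_normed_vector) \<Rightarrow> real^'n \<Rightarrow> real^'n \<Rightarrow> 'b" where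
  "dir_deriv f x \<xi> = vector_derivative (\<lambda>t. f (x + t *\<^sub>R \<xi>)) (at 0)"

definition op_norm :: "real^'n^'m \<Rightarrow> real" where
  "op_norm A = onorm ((*v) A)"

definition outer :: "real^'n \<Rightarrow> real^'n^'n" where
  "outer v = (columnvector v :: real^1^'n) ** (rowvector v :: real^'n^1)"

(* By the convention x / 0 = 0, each of the maps below is total; it has its intended meaning
   at points where the gradient of Lr (and, where a division by its norm occurs, q_vec) is
   nonzero. *)

definition P_r :: "(real^'n \<Rightarrow> real) \<Rightarrow> real^'n \<Rightarrow> real^'n^'n" where
  "P_r Lr w = (1 / (norm (grad Lr w))\<^sup>2) *\<^sub>R outer (grad Lr w)"

definition q_vec :: "(real^'n \<Rightarrow> real) \<Rightarrow> (real^'n \<Rightarrow> real) \<Rightarrow> real^'n \<Rightarrow> real^'n" where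
  "q_vec Lf Lr w = (mat 1 - P_r Lr w) *v grad Lf w"

definition P_perp :: "(real^'n \<Rightarrow> real) \<Rightarrow> (real^'n \<Rightarrow> real) \<Rightarrow> real^'n \<Rightarrow> real^'n^'n" where
  "P_perp Lf Lr w = (1 / (norm (q_vec Lf Lr w))\<^sup>2) *\<^sub>R outer (q_vec Lf Lr w)"

definition delta_rosu ::
    "(real^'n \<Rightarrow> real) \<Rightarrow> (real^'n \<Rightarrow> real) \<Rightarrow> real \<Rightarrow> real^'n \<Rightarrow> real^'n" where
  "delta_rosu Lf Lr \<rho> w = (\<rho> / norm (q_vec Lf Lr w)) *\<^sub>R q_vec Lf Lr w"

definition F_rosu ::
    "(real^'n \<Rightarrow> real) \<Rightarrow> (real^'n \<Rightarrow> real) \<Rightarrow> real \<Rightarrow> real^'n \<Rightarrow> real" where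
  "F_rosu Lf Lr \<rho> w = Lr (w + delta_rosu Lf Lr \<rho> w)"

definition g_tilde ::
    "(real^'n \<Rightarrow> real) \<Rightarrow> (real^'n \<Rightarrow> real) \<Rightarrow> real \<Rightarrow> real^'n \<Rightarrow> real^'n" where
  "g_tilde Lf Lr \<rho> w = grad Lr (w + delta_rosu Lf Lr \<rho> w)"

definition J_rosu ::
    "(real^'n \<Rightarrow> real) \<Rightarrow> (real^'n \<Rightarrow> real) \<Rightarrow> real \<Rightarrow> real^'n \<Rightarrow> real^'n^'n" where
  "J_rosu Lf Lr \<rho> w = jacobian (delta_rosu Lf Lr \<rho>) (at w)"

definition J_hat_rosu ::
    "(real^'n \<Rightarrow> real) \<Rightarrow> (real^'n \<Rightarrow> real) \<Rightarrow> real \<Rightarrow> real^'n \<Rightarrow> real^'n^'n" where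
  "J_hat_rosu Lf Lr \<rho> w =
    (\<rho> / norm (q_vec Lf Lr w)) *\<^sub>R (mat 1 - P_r Lr w - P_perp Lf Lr w)"

definition grad_hat_F_rosu ::
    "(real^'n \<Rightarrow> real) \<Rightarrow> (real^'n \<Rightarrow> real) \<Rightarrow> real \<Rightarrow> real^'n \<Rightarrow> real^'n" where
  "grad_hat_F_rosu Lf Lr \<rho> w =
    (mat 1 + transpose (J_hat_rosu Lf Lr \<rho> w)) *v g_tilde Lf Lr \<rho> w"

end

theory Submission
  imports Defs
begin

unbundle inner_syntax

text \<open>
  Write \<open>g\<^sub>f, H\<close> for the gradient and Hessian of \<open>L\<^sub>f\<close>. Since \<open>q\<close> is orthogonal to \<open>g\<^sub>r\<close>,
  \<open>P\<^sub>\<bottom> P\<^sub>r = 0\<close> and hence \<open>I - P\<^sub>r - P\<^sub>\<bottom> = (I - P\<^sub>\<bottom>) (I - P\<^sub>r)\<close>. Differentiating \<open>q\<close> and then its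
  normalization gives the exact error
  \<open>J - J_hat = \<rho> / \<parallel>q\<parallel> \<cdot> (I - P\<^sub>\<bottom>) ((I - P\<^sub>r) (H - I) - DP\<^sub>r[\<cdot>] g\<^sub>f)\<close>,
  and both projections have operator norm at most one. The gradient error is
  \<open>(J - J_hat)\<^sup>T\<close> applied to the gradient of \<open>L\<^sub>r\<close> at the perturbed point.
\<close>

section \<open>Gradients, Jacobians and directional derivatives from Frechet derivatives\<close>

lemma grad_eqI:
  assumes "GDERIV f x :> D"
  shows "grad f x = D"
  unfolding grad_def
proof (rule the_equality)
  fix E assume "GDERIV f x :> E"
  with assms have "(\<lambda>h. h \<bullet> E) = (\<lambda>h. h \<bullet> D)"
    unfolding gderiv_def using has_derivative_unique by blast
  then show "E = D"
    by (metis vector_eq_ldot)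
qed (fact assms)

lemma GDERIV_grad:
  assumes "f differentiable at x"
  shows "GDERIV f x :> grad f x"
proof -
  obtain f' where f': "(f has_derivative f') (at x)"
    using assms by (auto simp: differentiable_def)
  \<comment> \<open>The Riesz vector of the functional \<open>f'\<close> is its adjoint applied to
    1.\<close>
  have "f' = (\<lambda>h. h \<bullet> adjoint f' 1)"
    using adjoint_works[OF has_derivative_linear[OF f'], of _ 1] by (auto simp: inner_commute)
  with f' have "GDERIV f x :> adjoint f' 1"
    by (metis gderiv_def)
  then show ?thesis
    by (metis grad_eqI)
qed

lemma C2_GDERIV: "C2 f \<Longrightarrow> GDERIV f x :> grad f x"
  by (auto simp: C2_def differentiable_on_def intro: GDERIV_grad)

lemma C2_has_derivative_grad: "C2 f \<Longrightarrow> (grad f has_derivative (*v) (hessian f x)) (at x)"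
  unfolding hessian_def jacobian_works[symmetric] by (auto simp: C2_def differentiable_on_def)

lemma jacobian_eqI:
  fixes f :: "real^'n \<Rightarrow> real^'m"
  assumes "(f has_derivative f') (at x)"
  shows "jacobian f (at x) *v h = f' h"
  using assms jacobian_works differentiableI has_derivative_unique by metis

text \<open>Chain rule along the line through \<open>x\<close> in direction \<open>\<xi>\<close>.
  This turns the hypothesis on directional derivatives of \<open>P_r\<close> into one on its Frechet
  derivative, which is linear in the direction.\<close>

lemma dir_deriv_eqI:
  fixes f :: "real^'n \<Rightarrow> 'b::real_normed_vector"
  assumes f: "(f has_derivative f') (at x)"
  shows "dir_deriv f x \<xi> = f' \<xi>"
proof -
  have "((\<lambda>t. x + t *\<^sub>R \<xi>) has_derivative (\<lambda>t. t *\<^sub>R \<xi>)) (at 0)"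
    by (auto intro!: derivative_eq_intros)
  then have "((\<lambda>t. f (x + t *\<^sub>R \<xi>)) has_derivative (\<lambda>t. f' (t *\<^sub>R \<xi>))) (at 0)"
    by (rule has_derivative_compose) (use f in simp)
  then have "((\<lambda>t. f (x + t *\<^sub>R \<xi>)) has_vector_derivative f' \<xi>) (at 0)"
    using has_derivative_linear[OF f] by (simp add: has_vector_derivative_def linear_cmul)
  then show ?thesis
    unfolding dir_deriv_def by (rule vector_derivative_at)
qed

section \<open>Operator norms, outer products and projections\<close>

lemma norm_matrix_vector_le: "norm (A *v x) \<le> op_norm A * norm x"
  for A :: "real^'n^'m"
  unfolding op_norm_def by (rule onorm) simp

text \<open>Moving \<open>A\<close> across the inner product and applying Cauchy-Schwarz bounds the
  square of the left side; one factor then cancels. The gradient error needs this form because it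
  involves the transposed Jacobian error.\<close>

lemma norm_transpose_matrix_vector_le: "norm (transpose A *v x) \<le> op_norm A * norm x"
  for A :: "real^'n^'m"
proof -
  let ?y = "transpose A *v x"
  have "norm ?y * norm ?y = x \<bullet> (A *v ?y)"
    by (metis dot_lmul_matrix transpose_matrix_vector norm_eq_sqrt_inner real_sqrt_mult_self
        abs_of_nonneg inner_ge_zero)
  also have "\<dots> \<le> norm x * (op_norm A * norm ?y)"
    by (meson norm_cauchy_schwarz norm_matrix_vector_le mult_left_mono norm_ge_zero order_trans)
  finally have "norm ?y * norm ?y \<le> (op_norm A * norm x) * norm ?y"
    by (simp add: ac_simps)
  then show ?thesis
    \<comment> \<open>Cancellation fails for \<open>?y = 0\<close>; there the claim is nonnegativity
      of the right side.\<close>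
    by (metis mult_le_cancel_right norm_ge_zero norm_le_zero_iff onorm_pos_le op_norm_def
        matrix_vector_mul_bounded_linear mult_nonneg_nonneg order.trans linorder_not_le)
qed

lemma bounded_bilinear_matrix_vector_mult:
  "bounded_bilinear ((*v) :: real^'n^'m \<Rightarrow> real^'n \<Rightarrow> real^'m)"
  unfolding bilinear_conv_bounded_bilinear[symmetric] bilinear_def
  by (auto intro!: linearI simp: algebra_simps scaleR_matrix_vector_assoc)

lemma outer_mult: "outer v *v x = (v \<bullet> x) *\<^sub>R v"
  by (simp add: outer_def vec_eq_iff matrix_vector_mult_def matrix_matrix_mult_def
      columnvector_def rowvector_def inner_vec_def sum_distrib_left ac_simps)

text \<open>The map \<open>outer\<close> is a bilinear map restricted to the diagonal, so the
  product rule applies.\<close>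

lemma outer_differentiable: "(outer :: real^'n \<Rightarrow> real^'n^'n) differentiable at v"
proof -
  let ?B = "\<lambda>x y :: real^'n. (columnvector x :: real^1^'n) ** (rowvector y :: real^'n^1)"
  have "bilinear ?B"
    unfolding bilinear_def
    by (auto intro!: linearI simp: vec_eq_iff matrix_matrix_mult_def
      columnvector_def rowvector_def algebra_simps)
  then have "bounded_bilinear ?B"
    by (simp add: bilinear_conv_bounded_bilinear)
  from bounded_bilinear.FDERIV[OF this has_derivative_ident has_derivative_ident]
  show ?thesis
    unfolding outer_def[abs_def] by (rule differentiableI)
qed

text \<open>By Pythagoras, the squared norm drops by the square of the component along
  \<open>v\<close>. The main bound uses this twice, with \<open>v\<close> the gradient of
  \<open>Lr\<close> and with \<open>v\<close> the vector \<open>q_vec Lf Lr w\<close>.\<close>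

lemma norm_minus_projection_le:
  fixes v x :: "'a::real_inner"
  shows "norm (x - (v \<bullet> x / (norm v)\<^sup>2) *\<^sub>R v) \<le> norm x"
proof (cases "v = 0")
  case False
  define c where "c = v \<bullet> x / (norm v)\<^sup>2"
  have c: "c * (v \<bullet> v) = v \<bullet> x"
    using False by (simp add: c_def power2_norm_eq_inner)
  have "(norm (x - c *\<^sub>R v))\<^sup>2 = (norm x)\<^sup>2 - c * (v \<bullet> x)"
    by (simp add: power2_norm_eq_inner inner_diff inner_commute[of x v] c)
  also have "c * (v \<bullet> x) = (v \<bullet> x)\<^sup>2 / (norm v)\<^sup>2"
    by (simp add: c_def power2_eq_square)
  also have "(norm x)\<^sup>2 - \<dots> \<le> (norm x)\<^sup>2"
    by simp
  finally show ?thesis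
    unfolding c_def by (rule power2_le_imp_le) simp
qed simp

text \<open>Differentiating the factor 1 / norm removes the radial part of \<open>q'\<close>, so the
  projection orthogonal to \<open>q w\<close> appears, scaled by
  \<open>\<rho> / norm (q w)\<close>.\<close>

lemma has_derivative_normalize:
  fixes q :: "'a::real_normed_vector \<Rightarrow> 'b::real_inner"
  assumes q: "(q has_derivative q') (at w)" and nz: "q w \<noteq> 0"
  shows "((\<lambda>w. (\<rho> / norm (q w)) *\<^sub>R q w) has_derivative
    (\<lambda>h. (\<rho> / norm (q w)) *\<^sub>R (q' h - (q w \<bullet> q' h / (norm (q w))\<^sup>2) *\<^sub>R q w))) (at w)"
proof -
  have n: "((\<lambda>w. norm (q w)) has_derivative (\<lambda>h. q' h \<bullet> sgn (q w))) (at w)"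
    using has_derivative_compose[OF q has_derivative_norm[OF nz]] .
  show ?thesis
    by (rule has_derivative_eq_rhs,
        rule has_derivative_scaleR[OF has_derivative_divide[OF has_derivative_const n] q])
      (use nz in \<open>auto simp: fun_eq_iff sgn_div_norm divide_simps algebra_simps power2_eq_square inner_commute\<close>)
qed

section \<open>The derivatives of \<open>P_r\<close> and \<open>q_vec\<close>\<close>

lemma P_r_mult: "P_r Lr w *v x = (grad Lr w \<bullet> x / (norm (grad Lr w))\<^sup>2) *\<^sub>R grad Lr w"
  by (simp add: P_r_def outer_mult flip: scaleR_matrix_vector_assoc)

lemma P_perp_mult:
  "P_perp Lf Lr w *v x = (q_vec Lf Lr w \<bullet> x / (norm (q_vec Lf Lr w))\<^sup>2) *\<^sub>R q_vec Lf Lr w"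
  by (simp add: P_perp_def outer_mult flip: scaleR_matrix_vector_assoc)

lemma P_r_differentiable:
  assumes "C2 Lr" and nz: "grad Lr w \<noteq> 0"
  shows "P_r Lr differentiable at w"
proof -
  have g: "grad Lr differentiable at w"
    using C2_has_derivative_grad[OF assms(1)] by (rule differentiableI)
  have "(\<lambda>w. outer (grad Lr w)) differentiable at w"
    using differentiable_chain_at[OF g outer_differentiable] by (simp add: o_def)
  moreover have "(\<lambda>w. norm (grad Lr w)) differentiable at w"
    using differentiable_chain_at[OF g differentiable_norm_at[OF nz]] by (simp add: o_def)
  ultimately show ?thesis
    unfolding P_r_def[abs_def] using nz
    by (intro differentiable_scaleR differentiable_divide differentiable_power) auto
qed

text \<open>Product rule for (I - \<open>P_r\<close>) applied to \<open>grad Lf\<close>: the first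
  two terms come from the Hessian, the last from the motion of the projection.\<close>

lemma q_vec_has_derivative:
  assumes "C2 Lf" and P: "(P_r Lr has_derivative P') (at w)"
  shows "(q_vec Lf Lr has_derivative
    (\<lambda>h. hessian Lf w *v h - P_r Lr w *v (hessian Lf w *v h) - P' h *v grad Lf w)) (at w)"
  unfolding q_vec_def[abs_def]
  by (rule has_derivative_eq_rhs,
      rule bounded_bilinear.FDERIV[OF bounded_bilinear_matrix_vector_mult
        has_derivative_diff[OF has_derivative_const P] C2_has_derivative_grad[OF assms(1)]])
    (simp add: fun_eq_iff algebra_simps
      bounded_bilinear.minus_left[OF bounded_bilinear_matrix_vector_mult])

text \<open>Homogeneity carries the bound from unit directions to every \<open>h\<close>.\<close>

lemma op_norm_le_SUP_sphere:
  fixes T :: "real^'n \<Rightarrow> real^'m^'k"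
  assumes T: "bounded_linear T"
  shows "op_norm (T h) \<le> (SUP \<xi>\<in>{\<xi>. norm \<xi> = 1}. op_norm (T \<xi>)) * norm h"
proof (cases "h = 0")
  case True
  then have "(*v) (T h) = (\<lambda>x. 0)"
    by (simp add: fun_eq_iff linear_0[OF bounded_linear.linear[OF T]])
  then show ?thesis
    using True by (simp add: op_norm_def onorm_zero)
next
  case False
  obtain K where K: "\<And>(A :: real^'m^'k) x. norm (A *v x) \<le> norm A * norm x * K" and "0 \<le> K"
    using bounded_bilinear.nonneg_bounded[OF bounded_bilinear_matrix_vector_mult] by metis
  obtain M where M: "\<And>x. norm (T x) \<le> norm x * M"
    using bounded_linear.bounded[OF T] by blast
  have "op_norm (T \<xi>) \<le> M * K" if "norm \<xi> = 1" for \<xi>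
    unfolding op_norm_def
  proof (rule onorm_le)
    fix x
    have "norm (T \<xi> *v x) \<le> norm (T \<xi>) * norm x * K"
      by (rule K)
    also have "\<dots> \<le> M * norm x * K"
      using M[of \<xi>] that \<open>0 \<le> K\<close> by (intro mult_right_mono) auto
    finally show "norm (T \<xi> *v x) \<le> M * K * norm x"
      by (simp add: ac_simps)
  qed
  \<comment> \<open>A real \<open>SUP\<close> is known to dominate its members only for a family
    bounded above; boundedness of \<open>T\<close> supplies this.\<close>
  then have bdd: "bdd_above ((\<lambda>\<xi>. op_norm (T \<xi>)) ` {\<xi>. norm \<xi> = 1})"
    by (intro bdd_aboveI2[where M = "M * K"]) simp
  have "T h = norm h *\<^sub>R T (sgn h)"
    using False linear_cmul[OF bounded_linear.linear[OF T], of "norm h" "sgn h"]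
    by (simp add: sgn_div_norm)
  then have "op_norm (T h) = norm h * op_norm (T (sgn h))"
    unfolding op_norm_def
    using onorm_scaleR[OF matrix_vector_mul_bounded_linear, of "norm h" "T (sgn h)"]
    by (simp add: scaleR_matrix_vector_assoc)
  also have "\<dots> \<le> norm h * (SUP \<xi>\<in>{\<xi>. norm \<xi> = 1}. op_norm (T \<xi>))"
    using False by (intro mult_left_mono cSUP_upper bdd) (auto simp: norm_sgn)
  finally show ?thesis
    by (simp add: ac_simps)
qed

section \<open>The exact Jacobian error and the gradient of \<open>F_rosu\<close>\<close>

lemma delta_rosu_has_derivative:
  assumes "C2 Lf" "C2 Lr" "grad Lr w \<noteq> 0" "q_vec Lf Lr w \<noteq> 0"
  shows "(delta_rosu Lf Lr \<rho> has_derivative (*v) (J_rosu Lf Lr \<rho> w)) (at w)"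
proof -
  obtain P' where "(P_r Lr has_derivative P') (at w)"
    using P_r_differentiable assms by (auto simp: differentiable_def)
  from has_derivative_normalize[OF q_vec_has_derivative[OF assms(1) this] assms(4), of \<rho>]
  show ?thesis
    unfolding J_rosu_def jacobian_works[symmetric] delta_rosu_def[abs_def] by (rule differentiableI)
qed

text \<open>Both matrices act as \<open>\<rho> / norm q\<close> times the projection orthogonal to
  \<open>q\<close>, applied to \<open>q' h\<close> and to (I - \<open>P_r\<close>) h respectively;
  \<open>e h\<close> is the difference of these two arguments.\<close>

lemma J_rosu_error:
  assumes "C2 Lf" "C2 Lr" "grad Lr w \<noteq> 0" "q_vec Lf Lr w \<noteq> 0"
    and P': "(P_r Lr has_derivative P') (at w)"
  defines "q \<equiv> q_vec Lf Lr w"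
  defines "e \<equiv> \<lambda>h. let u = (hessian Lf w - mat 1) *v h in u - P_r Lr w *v u - P' h *v grad Lf w"
  shows "(J_rosu Lf Lr \<rho> w - J_hat_rosu Lf Lr \<rho> w) *v h
    = (\<rho> / norm q) *\<^sub>R (e h - (q \<bullet> e h / (norm q)\<^sup>2) *\<^sub>R q)"
proof -
  define q' where
    "q' = (\<lambda>h. hessian Lf w *v h - P_r Lr w *v (hessian Lf w *v h) - P' h *v grad Lf w)"
  have J: "J_rosu Lf Lr \<rho> w *v h = (\<rho> / norm q) *\<^sub>R (q' h - (q \<bullet> q' h / (norm q)\<^sup>2) *\<^sub>R q)"
    unfolding J_rosu_def q_def q'_def delta_rosu_def[abs_def]
    using has_derivative_normalize[OF q_vec_has_derivative[OF assms(1) P'] assms(4)]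
    by (rule jacobian_eqI)
  have orth: "q \<bullet> grad Lr w = 0"
    using assms(3) unfolding q_def q_vec_def
    by (simp add: matrix_vector_mult_diff_rdistrib P_r_mult inner_diff inner_commute
        power2_norm_eq_inner)
  \<comment> \<open>The second summand is what \<open>q' h\<close> would be for identity Hessian and
    \<open>P' = 0\<close>.\<close>
  have e: "q' h = e h + (h - P_r Lr w *v h)"
    by (simp add: q'_def e_def Let_def algebra_simps)
  have qh: "q \<bullet> (h - P_r Lr w *v h) = q \<bullet> h"
    by (simp add: P_r_mult inner_diff_right orth)
  have Jh: "J_hat_rosu Lf Lr \<rho> w *v h
      = (\<rho> / norm q) *\<^sub>R (h - P_r Lr w *v h - (q \<bullet> h / (norm q)\<^sup>2) *\<^sub>R q)"
    by (simp add: J_hat_rosu_def P_perp_mult matrix_vector_mult_diff_rdistrib q_def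
        flip: scaleR_matrix_vector_assoc)
  show ?thesis
    unfolding matrix_vector_mult_diff_rdistrib J Jh e inner_add_right qh
    by (simp add: algebra_simps add_divide_distrib)
qed

text \<open>Chain rule; the transpose arises when the Jacobian is moved to the other side of the
  inner product to read off the gradient.\<close>

lemma grad_F_rosu:
  assumes "C2 Lf" "C2 Lr" "grad Lr w \<noteq> 0" "q_vec Lf Lr w \<noteq> 0"
  shows "grad (F_rosu Lf Lr \<rho>) w = (mat 1 + transpose (J_rosu Lf Lr \<rho> w)) *v g_tilde Lf Lr \<rho> w"
proof (rule grad_eqI)
  let ?J = "J_rosu Lf Lr \<rho> w" and ?g = "g_tilde Lf Lr \<rho> w"
  have "((\<lambda>w. w + delta_rosu Lf Lr \<rho> w) has_derivative (\<lambda>h. h + ?J *v h)) (at w)"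
    by (intro has_derivative_add has_derivative_ident delta_rosu_has_derivative assms)
  then have "(F_rosu Lf Lr \<rho> has_derivative (\<lambda>h. (h + ?J *v h) \<bullet> ?g)) (at w)"
    unfolding F_rosu_def[abs_def] g_tilde_def
    by (rule has_derivative_compose) (use C2_GDERIV[OF assms(2)] in \<open>simp add: gderiv_def\<close>)
  moreover have "(h + ?J *v h) \<bullet> ?g = h \<bullet> ((mat 1 + transpose ?J) *v ?g)" for h
    by (simp add: algebra_simps inner_add_left inner_add_right inner_commute[of "?J *v h"]
        inner_commute[of h "?g v* ?J"] dot_lmul_matrix transpose_matrix_vector)
  ultimately show "GDERIV (F_rosu Lf Lr \<rho>) w :> (mat 1 + transpose ?J) *v ?g"
    by (simp add: gderiv_def)
qed

theorem proposition3:
  fixes Lf Lr :: "real^'n \<Rightarrow> real" and \<rho> \<epsilon>\<^sub>H \<epsilon>\<^sub>P :: real and w :: "real^'n"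
  assumes "C2 Lf" and "C2 Lr"
    and "\<rho> > 0"
    and "grad Lr w \<noteq> 0" and "q_vec Lf Lr w \<noteq> 0"
    and "\<epsilon>\<^sub>H \<ge> 0" and "\<epsilon>\<^sub>P \<ge> 0"
    and "op_norm (hessian Lf w - mat 1) \<le> \<epsilon>\<^sub>H"
    and "(SUP \<xi>\<in>{\<xi>. norm \<xi> = 1}. op_norm (dir_deriv (P_r Lr) w \<xi>)) \<le> \<epsilon>\<^sub>P"
  shows "op_norm (J_rosu Lf Lr \<rho> w - J_hat_rosu Lf Lr \<rho> w)
      \<le> \<rho> / norm (q_vec Lf Lr w) * (\<epsilon>\<^sub>H + \<epsilon>\<^sub>P * norm (grad Lf w))
    \<and> norm (grad (F_rosu Lf Lr \<rho>) w - grad_hat_F_rosu Lf Lr \<rho> w)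
      \<le> \<rho> * norm (g_tilde Lf Lr \<rho> w) / norm (q_vec Lf Lr w)
          * (\<epsilon>\<^sub>H + \<epsilon>\<^sub>P * norm (grad Lf w))"
proof -
  let ?q = "q_vec Lf Lr w" and ?D = "J_rosu Lf Lr \<rho> w - J_hat_rosu Lf Lr \<rho> w"
  let ?g = "g_tilde Lf Lr \<rho> w"
  let ?c = "\<rho> / norm ?q * (\<epsilon>\<^sub>H + \<epsilon>\<^sub>P * norm (grad Lf w))"
  obtain P' where P': "(P_r Lr has_derivative P') (at w)"
    using P_r_differentiable assms by (auto simp: differentiable_def)
  have P'_le: "op_norm (P' h) \<le> \<epsilon>\<^sub>P * norm h" for h
  proof -
    have "op_norm (P' h) \<le> (SUP \<xi>\<in>{\<xi>. norm \<xi> = 1}. op_norm (P' \<xi>)) * norm h"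
      using P' by (intro op_norm_le_SUP_sphere has_derivative_bounded_linear)
    also have "\<dots> \<le> \<epsilon>\<^sub>P * norm h"
      using assms(9) by (intro mult_right_mono) (simp_all add: dir_deriv_eqI[OF P'])
    finally show ?thesis .
  qed
  have bound: "op_norm ?D \<le> ?c"
    unfolding op_norm_def
  proof (rule onorm_le)
    fix h :: "real^'n"
    define u where "u = (hessian Lf w - mat 1) *v h"
    define e where "e = u - P_r Lr w *v u - P' h *v grad Lf w"
    have "norm u \<le> op_norm (hessian Lf w - mat 1) * norm h"
      unfolding u_def by (rule norm_matrix_vector_le)
    also have "\<dots> \<le> \<epsilon>\<^sub>H * norm h"
      using assms(8) by (intro mult_right_mono) auto
    \<comment> \<open>Here the projection orthogonal to the gradient of \<open>Lr\<close> is
      dropped; the one orthogonal to \<open>?q\<close> is dropped after the two error terms are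
      added.\<close>
    finally have "norm (u - P_r Lr w *v u) \<le> \<epsilon>\<^sub>H * norm h"
      unfolding P_r_mult using norm_minus_projection_le order_trans by blast
    moreover have "norm (P' h *v grad Lf w) \<le> \<epsilon>\<^sub>P * norm h * norm (grad Lf w)"
      by (meson P'_le norm_matrix_vector_le mult_right_mono norm_ge_zero order_trans)
    ultimately have "norm e \<le> (\<epsilon>\<^sub>H + \<epsilon>\<^sub>P * norm (grad Lf w)) * norm h"
      unfolding e_def using norm_triangle_ineq4[of "u - P_r Lr w *v u" "P' h *v grad Lf w"]
      by (simp add: algebra_simps)
    then have "norm (e - (?q \<bullet> e / (norm ?q)\<^sup>2) *\<^sub>R ?q) \<le> (\<epsilon>\<^sub>H + \<epsilon>\<^sub>P * norm (grad Lf w)) * norm h"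
      using norm_minus_projection_le order_trans by blast
    then have "\<rho> / norm ?q * norm (e - (?q \<bullet> e / (norm ?q)\<^sup>2) *\<^sub>R ?q)
        \<le> \<rho> / norm ?q * ((\<epsilon>\<^sub>H + \<epsilon>\<^sub>P * norm (grad Lf w)) * norm h)"
      using assms(3) by (intro mult_left_mono) auto
    moreover have "?D *v h = (\<rho> / norm ?q) *\<^sub>R (e - (?q \<bullet> e / (norm ?q)\<^sup>2) *\<^sub>R ?q)"
      using J_rosu_error[OF assms(1,2,4,5) P', of \<rho> h] by (simp add: e_def u_def Let_def)
    ultimately show "norm (?D *v h) \<le> ?c * norm h"
      using assms(3) by (simp add: mult.assoc)
  qed
  \<comment> \<open>Exact and approximate gradient share the vector \<open>?g\<close>, so the
    identity parts cancel and only the Jacobian error remains.\<close>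
  have "grad (F_rosu Lf Lr \<rho>) w - grad_hat_F_rosu Lf Lr \<rho> w = transpose ?D *v ?g"
    unfolding grad_F_rosu[OF assms(1,2,4,5)] grad_hat_F_rosu_def
    by (simp add: algebra_simps transpose_matrix_vector vector_matrix_mult_diff_rdistrib)
  also have "norm \<dots> \<le> op_norm ?D * norm ?g"
    by (rule norm_transpose_matrix_vector_le)
  also have "\<dots> \<le> ?c * norm ?g"
    using bound by (rule mult_right_mono) simp
  finally show ?thesis
    using bound by (simp add: ac_simps)
qed

end
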